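(* Let $N\ge1$. As sets of functions of $x=(x_1,\dots,x_N)$, $$\left\{\frac{\Psi_m}{\Psi_{\boldsymbol c}}:m\in\mathfrak W_N\right\}=\left\{e^{i\delta\sum_{i=1}^Nx_i}\,s_\lambda\left(e^{ix_1},\dots,e^{ix_N}\right):\delta\in\mathbb Z,\ \lambda_1\ge\cdots\ge\lambda_N\ge0\right\},$$ where $\lambda=(\lambda_1,\dots,\lambda_N)$ ranges over integer partitions.
   Context: $\mathfrak W_N=\{m\in\mathbb Z^N:m_1<\cdots<m_N\}$; $\gamma=0$ if $N$ is odd and $\gamma=1/2$ if $N$ is even; for $x\in\mathbb R^N$, $\Psi_m(x)=(2\pi)^{-N/2}\det\big(e^{i(m_k+\gamma)x_l}\big)_{1\le k,l\le N}$; $\boldsymbol c=(-p,\dots,p)$ if $N=2p+1$ and $\boldsymbol c=(-p,\dots,p-1)$ if $N=2p$. Quotients $\Psi_m/\Psi_{\boldsymbol c}$ are extended by continuity where $\Psi_{\boldsymbol c}$ vanishes. The Schur polynomial is $s_\lambda(X_1,\dots,X_N)=\det(X_j^{\lambda_i+N-i})_{1\le i,j\le N}/\det(X_j^{N-i})_{1\le i,j\le N}$. *)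

theory Defs
  imports
    "HOL-Analysis.Analysis"
    "HOL-Library.Poly_Mapping"
    "Jordan_Normal_Form.Determinant"
begin

text \<open>
  \<open>\<real>\<^sup>N\<close> is the library's \<^term>\<open>topspace (Euclidean_space N)\<close>: functions \<open>nat \<Rightarrow> real\<close> vanishing
  at all indices \<open>\<ge> N\<close>. Tuples of integers are lists. All indices are shifted to start at 0.
\<close>

abbreviation RN :: "nat \<Rightarrow> (nat \<Rightarrow> real) set" where
  "RN N \<equiv> topspace (Euclidean_space N)"

definition \<WW> :: "nat \<Rightarrow> int list set" where
  "\<WW> N = {m. length m = N \<and> sorted_wrt (<) m}"

definition \<gamma> :: "nat \<Rightarrow> real" where
  "\<gamma> N = (if odd N then 0 else 1 / 2)"

definition cvec :: "nat \<Rightarrow> int list" where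
  "cvec N = (let p = int (N div 2) in if odd N then [-p..p] else [-p..p - 1])"

definition \<Psi> :: "nat \<Rightarrow> int list \<Rightarrow> (nat \<Rightarrow> real) \<Rightarrow> complex" where
  "\<Psi> N m x = of_real ((2 * pi) powr (- real N / 2)) *
     Determinant.det (Matrix.mat N N (\<lambda>(k, l). exp (\<i> * of_real ((real_of_int (m ! k) + \<gamma> N) * x l))))"

text \<open>
  The quotient \<open>\<Psi>\<^sub>m / \<Psi>\<^sub>c\<close> at a point of \<open>\<real>\<^sup>N\<close>; at a zero of \<open>\<Psi>\<^sub>c\<close> it is the limit of the
  quotient along the points of \<open>\<real>\<^sup>N\<close> where \<open>\<Psi>\<^sub>c\<close> does not vanish.
  The product topology of \<open>nat \<Rightarrow> real\<close> induces the Euclidean topology on \<^term>\<open>RN N\<close>.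
\<close>

definition \<Psi>_quot :: "nat \<Rightarrow> int list \<Rightarrow> (nat \<Rightarrow> real) \<Rightarrow> complex" where
  "\<Psi>_quot N m x =
     (if \<Psi> N (cvec N) x \<noteq> 0 then \<Psi> N m x / \<Psi> N (cvec N) x
      else Lim (at x within {y \<in> RN N. \<Psi> N (cvec N) y \<noteq> 0}) (\<lambda>y. \<Psi> N m y / \<Psi> N (cvec N) y))"

text \<open>Polynomials in the variables \<open>X\<^sub>0, X\<^sub>1, \<dots>\<close>, as finitely supported maps from monomials
  (exponent maps) to coefficients.\<close>

type_synonym 'a mpolynomial = "(nat \<Rightarrow>\<^sub>0 nat) \<Rightarrow>\<^sub>0 'a"

definition pvar :: "nat \<Rightarrow> 'a::comm_ring_1 mpolynomial" where
  "pvar j = Poly_Mapping.single (Poly_Mapping.single j 1) 1"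

definition mpoly_eval :: "'a::comm_ring_1 mpolynomial \<Rightarrow> (nat \<Rightarrow> 'a) \<Rightarrow> 'a" where
  "mpoly_eval p z = (\<Sum>e\<in>Poly_Mapping.keys p. Poly_Mapping.lookup p e *
     (\<Prod>j\<in>Poly_Mapping.keys e. z j ^ Poly_Mapping.lookup e j))"

definition partitions :: "nat \<Rightarrow> nat list set" where
  "partitions N = {la. length la = N \<and> sorted_wrt (\<ge>) la}"

text \<open>The quotient of the two determinants is exact in the polynomial ring, which is an integral
  domain; \<open>schur\<close> is this quotient. With indices starting at 0, the exponent \<open>N - i\<close> becomes
  \<open>N - 1 - i\<close>.\<close>

definition schur :: "nat list \<Rightarrow> 'a::idom mpolynomial" where
  "schur la = (let N = length la in
     THE s. s * Determinant.det (Matrix.mat N N (\<lambda>(i, j). pvar j ^ (N - 1 - i)))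
          = Determinant.det (Matrix.mat N N (\<lambda>(i, j). pvar j ^ (la ! i + (N - 1 - i)))))"

end

theory Submission imports Defs begin

text \<open>
  With \<open>z\<^sub>l = e\<^bsup>i x\<^sub>l\<^esup>\<close>, the determinant \<open>\<Psi>\<^sub>m\<close> is a bialternant in disguise. A strictly increasing
  \<open>m\<close> differs from the consecutive integers \<open>c\<close> by a weakly increasing sequence, hence by an integer
  shift \<open>\<delta>\<close> plus a partition \<open>\<lambda>\<close> read backwards, and this correspondence reaches every pair
  \<open>(\<delta>, \<lambda>)\<close>. Pulling the factors \<open>e\<^bsup>i \<delta> x\<^sub>l\<^esup>\<close> and those coming from \<open>\<gamma>\<close> out of the columns, and
  reversing the rows, turns \<open>\<Psi>\<^sub>m\<close> into the numerator of the Schur polynomial at \<open>z\<close>; the same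
  operations turn \<open>\<Psi>\<^sub>c\<close> into the Vandermonde determinant. All prefactors except
  \<open>e\<^bsup>i \<delta> \<Sum>x\<^esup>\<close> agree, so \<open>\<Psi>\<^sub>m = e\<^bsup>i \<delta> \<Sum>x\<^esup> s\<^sub>\<lambda>(z) \<Psi>\<^sub>c\<close> holds at every point
  (\<open>Psi_eq_schur_mult_Psi_cvec\<close>).

  This needs the Schur polynomial to be a true quotient in the polynomial ring. Every power
  \<open>z\<^sub>j\<^sup>a\<close> can be reduced modulo the monic polynomial \<open>\<Prod>\<^sub>l (T - z\<^sub>l)\<close> to a combination of
  \<open>1, z\<^sub>j, \<dots>, z\<^sub>j\<^bsup>N-1\<^esup>\<close> with coefficients independent of \<open>j\<close>. Hence the matrix of any alternant
  is a product of a coefficient matrix with the Vandermonde matrix, which gives divisibility in any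
  commutative ring (\<open>vandermonde_dvd_alternant\<close>).
  Evaluation is a ring homomorphism and carries the identity from polynomials to complex numbers.

  At a zero of \<open>\<Psi>\<^sub>c\<close>, the factor in front of \<open>\<Psi>\<^sub>c\<close> is continuous in \<open>x\<close>, so it is the limit of the
  quotient, provided the zero can be approached through points where \<open>\<Psi>\<^sub>c\<close> does not vanish. Moving the
  coordinates with pairwise different speeds does this, as it separates the numbers \<open>z\<^sub>l\<close>
  (\<open>islimpt_nonzero_Psi_cvec\<close>).
\<close>

section \<open>Alternants\<close>

definition alternant :: "nat \<Rightarrow> (nat \<Rightarrow> 'a::comm_ring_1) \<Rightarrow> (nat \<Rightarrow> nat) \<Rightarrow> 'a" where
  "alternant N z a = Determinant.det (Matrix.mat N N (\<lambda>(i, j). z j ^ a i))"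

lemma coeff_prod_linear_factors:
  fixes z :: "nat \<Rightarrow> 'a::comm_ring_1"
  shows "Polynomial.coeff (\<Prod>l<N. [:- z l, 1:]) N = 1"
    and "\<And>k. k > N \<Longrightarrow> Polynomial.coeff (\<Prod>l<N. [:- z l, 1:]) k = 0"
proof (induction N)
  case 0
  {
    case 1
    show ?case by simp
  next
    case (2 k)
    then show ?case by simp
  }
next
  case (Suc N)
  have step: "(\<Prod>l<Suc N. [:- z l, 1:])
      = Polynomial.smult (- z N) (\<Prod>l<N. [:- z l, 1:]) + pCons 0 (\<Prod>l<N. [:- z l, 1:])"
    by (simp add: mult.commute[of _ "[:- z N, 1:]"])
  {
    case 1
    show ?case unfolding step using Suc by simp
  next
    case (2 k)
    then show ?case unfolding step using Suc by (simp add: coeff_pCons split: nat.split)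
  }
qed

text \<open>
  This is reduction of \<open>T\<^sup>a\<close> modulo the monic polynomial \<open>\<Prod>\<^sub>l (T - z\<^sub>l)\<close> of degree \<open>N\<close>, which vanishes
  at all the \<open>z\<^sub>j\<close>; the point is that one remainder \<open>r\<close> serves all of them.
\<close>
lemma common_power_reduction:
  fixes z :: "nat \<Rightarrow> 'a::comm_ring_1"
  shows "\<exists>r. \<forall>j<N. z j ^ a = (\<Sum>k<N. r k * z j ^ k)"
proof (induction a)
  case 0
  have "z j ^ 0 = (\<Sum>k<N. (if k = 0 then 1 else 0) * z j ^ k)" if "j < N" for j
  proof -
    have "(\<Sum>k<N. (if k = 0 then 1 else 0) * z j ^ k) = (\<Sum>k<N. if k = 0 then 1 else 0)"
      by (rule sum.cong) auto
    also have "\<dots> = 1" using that by (simp add: sum.delta)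
    finally show ?thesis by simp
  qed
  then show ?case by (intro exI[of _ "\<lambda>k. if k = 0 then 1 else 0"] allI impI)
next
  case (Suc a)
  then obtain r where r: "\<And>j. j < N \<Longrightarrow> z j ^ a = (\<Sum>k<N. r k * z j ^ k)" by blast
  show ?case
  proof (cases N)
    case 0
    then show ?thesis by simp
  next
    case (Suc n)
    define P where "P = (\<Prod>l<N. [:- z l, 1:])"
    have P1: "Polynomial.coeff P N = 1" and P0: "\<And>k. k > N \<Longrightarrow> Polynomial.coeff P k = 0"
      unfolding P_def by (rule coeff_prod_linear_factors, erule coeff_prod_linear_factors)
    have top: "z j ^ N = - (\<Sum>k<N. Polynomial.coeff P k * z j ^ k)" if "j < N" for j
    proof -
      have deg: "Polynomial.degree P \<le> N" using P0 by (intro degree_le) auto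
      have "poly P (z j) = 0"
        unfolding P_def poly_prod by (rule prod_zero[OF finite_lessThan]) (use that in \<open>auto intro: bexI[of _ j]\<close>)
      moreover have "poly P (z j) = (\<Sum>k\<le>N. Polynomial.coeff P k * z j ^ k)"
        unfolding poly_altdef using deg P0
        by (intro sum.mono_neutral_left) (auto simp: coeff_eq_0)
      ultimately show ?thesis using P1 
        by (simp add: lessThan_Suc_atMost[symmetric] eq_neg_iff_add_eq_0 add.commute)
    qed
    \<comment> \<open>Multiply the reduction of \<open>T\<^sup>a\<close> by \<open>T\<close> and replace the new top power \<open>T\<^sup>N\<close> via \<open>top\<close>.\<close>
    define r' where "r' k = (case k of 0 \<Rightarrow> 0 | Suc i \<Rightarrow> r i) - r n * Polynomial.coeff P k" for k
    have "z j ^ Suc a = (\<Sum>k<N. r' k * z j ^ k)" if "j < N" for j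
    proof -
      have "(\<Sum>k<N. (case k of 0 \<Rightarrow> 0 | Suc i \<Rightarrow> r i) * z j ^ k) = (\<Sum>k<n. r k * z j ^ Suc k)"
        unfolding Suc by (subst sum.lessThan_Suc_shift) simp
      then have "(\<Sum>k<N. r' k * z j ^ k)
          = (\<Sum>k<n. r k * z j ^ Suc k) + r n * z j ^ N"
        unfolding top[OF that] r'_def
        by (simp add: left_diff_distrib sum_subtractf sum_distrib_left mult.assoc)
      also have "\<dots> = (\<Sum>k<N. r k * z j ^ Suc k)" unfolding Suc by simp
      also have "\<dots> = z j ^ Suc a"
        using r[OF that] by (simp add: sum_distrib_left mult_ac)
      finally show ?thesis by simp
    qed
    then show ?thesis by (intro exI[of _ r'] allI impI)
  qed
qed

text \<open>
  The coefficients of the reduced rows form a matrix \<open>R\<close>, and the matrix of the alternant is \<open>R\<close>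
  times the Vandermonde matrix.
\<close>
lemma vandermonde_dvd_alternant:
  fixes z :: "nat \<Rightarrow> 'a::comm_ring_1"
  shows "alternant N z (\<lambda>i. N - 1 - i) dvd alternant N z a"
proof -
  have "\<exists>r. \<forall>i. \<forall>j<N. z j ^ a i = (\<Sum>k<N. r i k * z j ^ k)"
    by (rule choice) (intro allI common_power_reduction)
  then obtain r where r: "\<And>i j. j < N \<Longrightarrow> z j ^ a i = (\<Sum>k<N. r i k * z j ^ k)" by blast
  define R where "R = Matrix.mat N N (\<lambda>(i, k). r i (N - 1 - k))"
  define V where "V = Matrix.mat N N (\<lambda>(k, j). z j ^ (N - 1 - k))"
  have "Matrix.mat N N (\<lambda>(i, j). z j ^ a i) = R * V"
  proof (rule eq_matI)
    fix i j assume "i < dim_row (R * V)" "j < dim_col (R * V)"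
    then have ij: "i < N" "j < N" by (auto simp: R_def V_def)
    have "(R * V) $$ (i, j) = (\<Sum>k<N. r i (N - Suc k) * z j ^ (N - Suc k))"
      using ij by (simp add: R_def V_def scalar_prod_def atLeast0LessThan)
    also have "\<dots> = (\<Sum>k<N. r i k * z j ^ k)"
      by (rule sum.nat_diff_reindex)
    finally show "Matrix.mat N N (\<lambda>(i, j). z j ^ a i) $$ (i, j) = (R * V) $$ (i, j)"
      using ij r by simp
  qed (auto simp: R_def V_def)
  moreover have "R \<in> carrier_mat N N" "V \<in> carrier_mat N N" by (auto simp: R_def V_def)
  ultimately show ?thesis unfolding alternant_def V_def[symmetric]
    by (simp add: det_mult)
qed

text \<open>
  A linear relation between the rows is a nonzero polynomial of degree less than \<open>N\<close> vanishing at
  \<open>N\<close> different points.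
\<close>
lemma vandermonde_nonzero:
  fixes z :: "nat \<Rightarrow> 'a::field"
  assumes "inj_on z {..<N}"
  shows "alternant N z (\<lambda>i. N - 1 - i) \<noteq> 0"
proof
  define V where "V = Matrix.mat N N (\<lambda>(k, j). z j ^ (N - 1 - k))"
  have V: "V \<in> carrier_mat N N" by (simp add: V_def)
  assume "alternant N z (\<lambda>i. N - 1 - i) = 0"
  then have "Determinant.det (transpose_mat V) = 0"
    unfolding det_transpose[OF V] by (simp add: alternant_def V_def)
  then obtain v where v: "v \<in> carrier_vec N" "v \<noteq> 0\<^sub>v N" "transpose_mat V *\<^sub>v v = 0\<^sub>v N"
    using det_0_iff_vec_prod_zero_field[of "transpose_mat V" N] V by auto
  define Q where "Q = (\<Sum>k<N. Polynomial.monom (v $ k) (N - 1 - k))"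
  have coeffQ: "Polynomial.coeff Q (N - 1 - k) = v $ k" if "k < N" for k
  proof -
    have "Polynomial.coeff Q (N - 1 - k) = (\<Sum>i<N. if i = k then v $ i else 0)"
      unfolding Q_def coeff_sum by (rule sum.cong) (use that in auto)
    also have "\<dots> = v $ k" using that by simp
    finally show ?thesis .
  qed
  have "\<exists>k<N. v $ k \<noteq> 0"
  proof (rule ccontr)
    assume "\<not> ?thesis"
    then have "v = 0\<^sub>v N" using v(1) by (intro eq_vecI) auto
    then show False using v(2) by simp
  qed
  then obtain k where k: "k < N" "v $ k \<noteq> 0" by blast
  have "Q \<noteq> 0" using coeffQ[OF k(1)] k(2) by auto
  have "Polynomial.degree Q \<le> N - 1"
    unfolding Q_def by (intro degree_sum_le) (auto intro: order.trans[OF degree_monom_le])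
  moreover have "poly Q (z j) = 0" if "j < N" for j
  proof -
    have "0 = (transpose_mat V *\<^sub>v v) $ j" using v(3) that by simp
    also have "\<dots> = (\<Sum>k<N. z j ^ (N - 1 - k) * v $ k)"
      using that v(1) by (simp add: V_def scalar_prod_def atLeast0LessThan)
    also have "\<dots> = poly Q (z j)"
      by (simp add: Q_def poly_sum poly_monom mult.commute)
    finally show ?thesis by simp
  qed
  then have "z ` {..<N} \<subseteq> {t. poly Q t = 0}" by auto
  then have "card (z ` {..<N}) \<le> card {t. poly Q t = 0}"
    by (rule card_mono[OF poly_roots_finite[OF \<open>Q \<noteq> 0\<close>]])
  then have "N \<le> Polynomial.degree Q"
    using card_poly_roots_bound[OF \<open>Q \<noteq> 0\<close>] card_image[OF assms] by simp
  ultimately show False using k(1) by simp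
qed

section \<open>Evaluation of polynomials\<close>

definition monomial_eval :: "(nat \<Rightarrow> 'a::comm_ring_1) \<Rightarrow> (nat \<Rightarrow>\<^sub>0 nat) \<Rightarrow> 'a" where
  "monomial_eval z e = (\<Prod>j\<in>Poly_Mapping.keys e. z j ^ Poly_Mapping.lookup e j)"

lemma monomial_eval_superset:
  assumes "finite S" "Poly_Mapping.keys e \<subseteq> S"
  shows "monomial_eval z e = (\<Prod>j\<in>S. z j ^ Poly_Mapping.lookup e j)"
  unfolding monomial_eval_def
  by (rule prod.mono_neutral_left) (use assms in \<open>auto simp: in_keys_iff\<close>)

lemma monomial_eval_add: "monomial_eval z (e + f) = monomial_eval z e * monomial_eval z f"
proof -
  let ?S = "Poly_Mapping.keys e \<union> Poly_Mapping.keys f"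
  have "finite ?S" "Poly_Mapping.keys (e + f) \<subseteq> ?S" by (auto simp: Poly_Mapping.keys_add)
  then show ?thesis
    by (simp add: monomial_eval_superset[of ?S] lookup_add power_add prod.distrib)
qed

lemma mpoly_eval_superset:
  assumes "finite S" "Poly_Mapping.keys p \<subseteq> S"
  shows "mpoly_eval p z = (\<Sum>e\<in>S. Poly_Mapping.lookup p e * monomial_eval z e)"
  unfolding mpoly_eval_def monomial_eval_def
  by (rule sum.mono_neutral_left) (use assms in \<open>auto simp: in_keys_iff\<close>)

lemma mpoly_eval_add: "mpoly_eval (p + q) z = mpoly_eval p z + mpoly_eval q z"
proof -
  let ?S = "Poly_Mapping.keys p \<union> Poly_Mapping.keys q"
  have "finite ?S" "Poly_Mapping.keys (p + q) \<subseteq> ?S" by (auto simp: Poly_Mapping.keys_add)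
  then show ?thesis
    by (simp add: mpoly_eval_superset[of ?S] lookup_add distrib_right sum.distrib)
qed

lemma mpoly_eval_zero: "mpoly_eval 0 z = 0"
  by (simp add: mpoly_eval_def)

lemma mpoly_eval_sum: "mpoly_eval (\<Sum>i\<in>I. p i) z = (\<Sum>i\<in>I. mpoly_eval (p i) z)"
  by (induction I rule: infinite_finite_induct) (auto simp: mpoly_eval_add mpoly_eval_zero)

lemma mpoly_eval_single: "mpoly_eval (Poly_Mapping.single e c) z = c * monomial_eval z e"
  by (subst mpoly_eval_superset[of "{e}"]) auto

lemma mpolynomial_as_sum:
  "p = (\<Sum>e\<in>Poly_Mapping.keys p. Poly_Mapping.single e (Poly_Mapping.lookup p e))"
  by (rule poly_mapping_eqI)
    (simp add: lookup_sum lookup_single when_def sum.delta in_keys_iff)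

lemma mpoly_eval_mult: "mpoly_eval (p * q) z = mpoly_eval p z * mpoly_eval q z"
proof -
  have "mpoly_eval (p * q) z = (\<Sum>e\<in>Poly_Mapping.keys p. \<Sum>f\<in>Poly_Mapping.keys q.
      (Poly_Mapping.lookup p e * monomial_eval z e) * (Poly_Mapping.lookup q f * monomial_eval z f))"
    by (subst mpolynomial_as_sum[of p], subst mpolynomial_as_sum[of q])
      (simp add: sum_product mpoly_eval_sum mult_single mpoly_eval_single monomial_eval_add mult_ac)
  also have "\<dots> = mpoly_eval p z * mpoly_eval q z"
    by (simp add: mpoly_eval_def monomial_eval_def sum_product)
  finally show ?thesis .
qed

lemma mpoly_eval_one: "mpoly_eval 1 z = 1"
  by (simp add: single_one[symmetric] mpoly_eval_single monomial_eval_def del: single_one)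

lemma mpoly_eval_pvar: "mpoly_eval (pvar j) z = z j"
  by (simp add: pvar_def mpoly_eval_single monomial_eval_def)

lemma mpoly_eval_hom: "comm_ring_hom (\<lambda>p. mpoly_eval p z)"
  by unfold_locales (simp_all add: mpoly_eval_add mpoly_eval_mult mpoly_eval_one mpoly_eval_zero)

lemma mpoly_eval_alternant: "mpoly_eval (alternant N pvar a) z = alternant N z a"
proof -
  interpret comm_ring_hom "\<lambda>p. mpoly_eval p z" by (rule mpoly_eval_hom)
  have "map_mat (\<lambda>p. mpoly_eval p z) (Matrix.mat N N (\<lambda>(i, j). pvar j ^ a i))
      = Matrix.mat N N (\<lambda>(i, j). z j ^ a i)"
    by (rule eq_matI) (auto simp: hom_power mpoly_eval_pvar)
  then show ?thesis
    unfolding alternant_def by (metis hom_det)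
qed

section \<open>Schur polynomials\<close>

text \<open>
  A quotient exists by divisibility. It is unique because the Vandermonde polynomial is nonzero:
  characteristic 0 supplies the different points \<open>0, 1, 2, \<dots>\<close> at which to evaluate it.
\<close>
lemma schur_mult_vandermonde:
  fixes la :: "nat list"
  defines "N \<equiv> length la"
  shows "(schur la :: 'a::field_char_0 mpolynomial) * alternant N pvar (\<lambda>i. N - 1 - i)
    = alternant N pvar (\<lambda>i. la ! i + (N - 1 - i))"
proof -
  let ?V = "alternant N pvar (\<lambda>i. N - 1 - i) :: 'a mpolynomial"
  let ?A = "alternant N pvar (\<lambda>i. la ! i + (N - 1 - i)) :: 'a mpolynomial"
  have "mpoly_eval ?V of_nat \<noteq> 0"
    unfolding mpoly_eval_alternant by (rule vandermonde_nonzero) (auto simp: inj_on_def)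
  then have "?V \<noteq> 0" by (auto simp: mpoly_eval_zero)
  obtain s where "?A = ?V * s" using vandermonde_dvd_alternant by (rule dvdE)
  then have "s * ?V = ?A" by (simp add: mult.commute)
  then have "\<exists>!s. s * ?V = ?A"
  proof (rule ex1I)
    fix t assume "t * ?V = ?A"
    then have "t * ?V = s * ?V" using \<open>s * ?V = ?A\<close> by (rule trans[OF _ sym])
    then show "t = s" using \<open>?V \<noteq> 0\<close> by (rule mult_right_cancel[THEN iffD1, rotated])
  qed
  then have "(THE s. s * ?V = ?A) * ?V = ?A" by (rule theI')
  moreover have "schur la = (THE s. s * ?V = ?A)"
    unfolding schur_def alternant_def N_def Let_def by (rule refl)
  ultimately show ?thesis by (rule ssubst[rotated])
qed

lemma schur_eval:
  fixes z :: "nat \<Rightarrow> 'a::field_char_0"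
  assumes "length la = N"
  shows "alternant N z (\<lambda>i. la ! i + (N - 1 - i))
    = mpoly_eval (schur la) z * alternant N z (\<lambda>i. N - 1 - i)"
  using arg_cong[OF schur_mult_vandermonde[of la], of "\<lambda>p. mpoly_eval p z"] assms
  by (simp add: mpoly_eval_mult mpoly_eval_alternant)

section \<open>The functions \<Psi> as alternants\<close>

text \<open>
  The label \<open>m\<close> belonging to \<open>(\<delta>, \<lambda>)\<close>: partitions decrease and labels increase, so \<open>\<lambda>\<close> is read
  backwards; \<open>k - N div 2\<close> is the \<open>k\<close>-th entry of \<open>c\<close> for both parities of \<open>N\<close>.
\<close>
definition shifted_weight :: "nat \<Rightarrow> int \<Rightarrow> nat list \<Rightarrow> int list" where
  "shifted_weight N \<delta> la =
     map (\<lambda>k. int (la ! (N - 1 - k)) + int k + \<delta> - int (N div 2)) [0..<N]"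

lemma shifted_weight_in_WW:
  assumes "la \<in> partitions N"
  shows "shifted_weight N \<delta> la \<in> \<WW> N"
proof -
  have "la ! (N - 1 - i) \<le> la ! (N - 1 - j)" if "i < j" "j < N" for i j
    using assms that unfolding partitions_def sorted_wrt_iff_nth_less by auto
  then show ?thesis
    by (auto simp: \<WW>_def shifted_weight_def sorted_wrt_iff_nth_less intro!: add_le_less_mono)
qed

text \<open>
  For a strictly increasing integer sequence, \<open>m\<^sub>k - k\<close> is weakly increasing. Its first value fixes
  \<open>\<delta>\<close>, which makes the last part of the partition 0; other pairs may give the same label.
\<close>
lemma WW_eq_shifted_weight:
  assumes "m \<in> \<WW> N"
  obtains \<delta> la where "la \<in> partitions N" "m = shifted_weight N \<delta> la"
proof -
  have len: "length m = N" and less: "\<And>i j. i < j \<Longrightarrow> j < N \<Longrightarrow> m ! i < m ! j"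
    using assms by (auto simp: \<WW>_def sorted_wrt_iff_nth_less)
  define d where "d k = m ! k - int k" for k
  have mono: "d i \<le> d j" if "i \<le> j" "j < N" for i j
    using that
  proof (induction j)
    case (Suc j)
    then show ?case using less[of j "Suc j"] by (cases "i = Suc j") (auto simp: d_def)
  qed simp
  define la where "la = map (\<lambda>i. nat (d (N - 1 - i) - d 0)) [0..<N]"
  have "la \<in> partitions N"
    by (auto simp: partitions_def la_def sorted_wrt_iff_nth_less intro!: nat_mono mono)
  moreover have "m = shifted_weight N (d 0 + int (N div 2)) la"
    by (rule nth_equalityI) (use len mono[of 0] in \<open>auto simp: shifted_weight_def la_def d_def\<close>)
  ultimately show ?thesis by (rule that)
qed

lemma cvec_eq_shifted_weight: "cvec N = shifted_weight N 0 (replicate N 0)"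
proof (rule nth_equalityI)
  show len: "length (cvec N) = length (shifted_weight N 0 (replicate N 0))"
    by (auto simp: cvec_def shifted_weight_def Let_def elim!: oddE evenE)
  fix k assume "k < length (cvec N)"
  then have "k < N" unfolding len by (simp add: shifted_weight_def)
  then show "cvec N ! k = shifted_weight N 0 (replicate N 0) ! k"
    by (auto simp: cvec_def shifted_weight_def Let_def elim!: oddE evenE)
qed

lemma det_scale_columns:
  fixes f :: "nat \<Rightarrow> nat \<Rightarrow> 'a::comm_ring_1"
  shows "Determinant.det (Matrix.mat N N (\<lambda>(k, l). w l * f k l))
    = (\<Prod>l<N. w l) * Determinant.det (Matrix.mat N N (\<lambda>(k, l). f k l))"
proof -
  have det: "Determinant.det (Matrix.mat N N (\<lambda>(k, l). h k l))
      = (\<Sum>p\<in>{p. p permutes {0..<N}}. signof p * (\<Prod>l<N. h (p l) l))"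
    for h :: "nat \<Rightarrow> nat \<Rightarrow> 'a"
  proof -
    have "(\<Prod>l = 0..<N. Matrix.mat N N (\<lambda>(k, l). h k l) $$ (p l, l)) = (\<Prod>l<N. h (p l) l)"
      if "p permutes {0..<N}" for p
      unfolding atLeast0LessThan
      by (rule prod.cong) (use permutes_in_image[OF that] in auto)
    then show ?thesis by (simp add: mat_det_left_def[where n = N])
  qed
  show ?thesis
    unfolding det by (simp add: prod.distrib sum_distrib_left mult_ac)
qed

definition row_reversal :: "nat \<Rightarrow> nat \<Rightarrow> nat" where
  "row_reversal N k = (if k < N then N - 1 - k else k)"

lemma row_reversal_permutes: "row_reversal N permutes {0..<N}"
  by (rule bij_imp_permutes, rule bij_betw_byWitness[where f' = "row_reversal N"])
    (auto simp: row_reversal_def)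

text \<open>
  The exponent \<open>m\<^sub>k + \<gamma>\<close> splits into the part \<open>\<gamma> - N div 2 + \<delta>\<close> common to all rows, which scales the
  columns, and the natural number \<open>\<lambda>\<^bsub>N-1-k\<^esub> + k\<close>, which after reversal of the rows is the exponent of the
  bialternant. Only the factor with \<open>\<delta>\<close> depends on the label, so the sign of the reversal and the
  half-integer shift cancel in quotients.
\<close>
lemma Psi_shifted_weight:
  fixes x :: "nat \<Rightarrow> real"
  shows "\<Psi> N (shifted_weight N \<delta> la) x =
    of_real ((2 * pi) powr (- real N / 2)) * signof (row_reversal N)
    * exp (\<i> * of_real (\<gamma> N - real (N div 2)) * of_real (\<Sum>l<N. x l))
    * exp (\<i> * of_int \<delta> * of_real (\<Sum>l<N. x l))
    * alternant N (\<lambda>l. exp (\<i> * of_real (x l))) (\<lambda>i. la ! i + (N - 1 - i))"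
proof -
  let ?z = "\<lambda>l. exp (\<i> * of_real (x l)) :: complex"
  define w where "w l = exp (\<i> * of_real (\<gamma> N - real (N div 2)) * of_real (x l))
    * exp (\<i> * of_int \<delta> * of_real (x l))" for l
  define A where "A = Matrix.mat N N (\<lambda>(i, l). ?z l ^ (la ! i + (N - 1 - i)))"
  have "Matrix.mat N N (\<lambda>(k, l). exp (\<i> * of_real ((real_of_int (shifted_weight N \<delta> la ! k) + \<gamma> N) * x l)))
      = Matrix.mat N N (\<lambda>(k, l). w l * A $$ (row_reversal N k, l))"
    by (rule eq_matI)
      (auto simp: shifted_weight_def w_def A_def row_reversal_def exp_add[symmetric]
        exp_of_nat_mult[symmetric] algebra_simps)
  moreover have "A \<in> carrier_mat N N" by (simp add: A_def)
  ultimately have "\<Psi> N (shifted_weight N \<delta> la) x = of_real ((2 * pi) powr (- real N / 2)) *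
      ((\<Prod>l<N. w l) * (signof (row_reversal N) * Determinant.det A))"
    unfolding \<Psi>_def by (simp only: det_scale_columns det_permute_rows row_reversal_permutes)
  moreover have "(\<Prod>l<N. w l) = exp (\<i> * of_real (\<gamma> N - real (N div 2)) * of_real (\<Sum>l<N. x l))
      * exp (\<i> * of_int \<delta> * of_real (\<Sum>l<N. x l))"
    by (simp only: w_def prod.distrib exp_sum[symmetric, OF finite_lessThan] of_real_sum sum_distrib_left)
  ultimately show ?thesis
    by (simp add: A_def alternant_def mult_ac)
qed

lemma Psi_cvec:
  fixes x :: "nat \<Rightarrow> real"
  shows "\<Psi> N (cvec N) x =
    of_real ((2 * pi) powr (- real N / 2)) * signof (row_reversal N)
    * exp (\<i> * of_real (\<gamma> N - real (N div 2)) * of_real (\<Sum>l<N. x l))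
    * alternant N (\<lambda>l. exp (\<i> * of_real (x l))) (\<lambda>i. N - 1 - i)"
proof -
  have "alternant N z (\<lambda>i. replicate N 0 ! i + (N - 1 - i)) = alternant N z (\<lambda>i. N - 1 - i)"
    for z :: "nat \<Rightarrow> complex"
    unfolding alternant_def by (rule arg_cong[of _ _ Determinant.det], rule eq_matI) auto
  then show ?thesis
    unfolding cvec_eq_shifted_weight Psi_shifted_weight by simp
qed

text \<open>
  Stated as a product, the identity also holds at the zeros of \<open>\<Psi>\<^sub>c\<close>.
\<close>
lemma Psi_eq_schur_mult_Psi_cvec:
  fixes x :: "nat \<Rightarrow> real"
  assumes "length la = N"
  shows "\<Psi> N (shifted_weight N \<delta> la) x =
    exp (\<i> * of_int \<delta> * of_real (\<Sum>l<N. x l))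
    * mpoly_eval (schur la) (\<lambda>j. exp (\<i> * of_real (x j))) * \<Psi> N (cvec N) x"
  unfolding Psi_shifted_weight Psi_cvec schur_eval[OF assms] by (simp add: mult_ac)

section \<open>Extension by continuity\<close>

lemma Psi_cvec_nonzero:
  assumes "inj_on (\<lambda>l. exp (\<i> * of_real (x l)) :: complex) {..<N}"
  shows "\<Psi> N (cvec N) x \<noteq> 0"
  using vandermonde_nonzero[OF assms] by (simp add: Psi_cvec sign_def)

text \<open>
  Along the line \<open>x\<^sub>l + t l\<close> the numbers \<open>e\<^bsup>i (x\<^sub>l + t l)\<^esup>\<close> are pairwise different for all small
  \<open>t \<noteq> 0\<close>: those different at \<open>t = 0\<close> stay so by continuity, and those equal at \<open>t = 0\<close> move apart at
  different speeds.
\<close>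
lemma islimpt_nonzero_Psi_cvec:
  assumes x: "x \<in> RN N" and zero: "\<Psi> N (cvec N) x = 0"
  shows "x islimpt {y \<in> RN N. \<Psi> N (cvec N) y \<noteq> 0}"
proof (rule islimptI)
  fix T assume T: "x \<in> T" "open T"
  define y where "y t l = x l + t * (if l < N then real l else 0)" for t l
  have y0: "y 0 = x" by (rule ext) (simp add: y_def)
  have "continuous_on UNIV y"
    unfolding y_def
    by (rule continuous_on_coordinatewise_then_product) (auto intro!: continuous_intros)
  then have "(y \<longlongrightarrow> x) (at 0)"
    using y0 by (metis UNIV_I continuous_on_def)
  then have ev1: "eventually (\<lambda>t. y t \<in> T) (at 0)"
    using T by (auto dest: topological_tendstoD)
  have pair: "eventually (\<lambda>t. exp (\<i> * of_real (y t j)) \<noteq> (exp (\<i> * of_real (y t k)) :: complex)) (at 0)"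
    if "j < N" "k < N" "j \<noteq> k" for j k
  proof (cases "exp (\<i> * of_real (x j)) = (exp (\<i> * of_real (x k)) :: complex)")
    case False
    have "((\<lambda>t. exp (\<i> * of_real (y t j)) - (exp (\<i> * of_real (y t k)) :: complex)) \<longlongrightarrow>
        exp (\<i> * of_real (y 0 j)) - exp (\<i> * of_real (y 0 k))) (at 0)"
      using that unfolding y_def by (auto intro!: tendsto_eq_intros)
    then have "eventually (\<lambda>t. exp (\<i> * of_real (y t j)) - (exp (\<i> * of_real (y t k)) :: complex) \<noteq> 0) (at 0)"
      by (rule tendsto_imp_eventually_ne) (use False y0 in auto)
    then show ?thesis by simp
  next
    case True
    \<comment> \<open>Two equal numbers can meet again only when \<open>t (j - k)\<close> is a nonzero multiple of \<open>2\<pi>\<close>.\<close>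
    define r where "r = 2 * pi / real N"
    have "r > 0" using that by (simp add: r_def)
    then have "eventually (\<lambda>t. t \<noteq> 0 \<and> \<bar>t\<bar> < r) (at 0)"
      unfolding eventually_at by (auto intro!: exI[of _ r] simp: dist_real_def)
    then show ?thesis
    proof eventually_elim
      case (elim t)
      show ?case
      proof
        assume "exp (\<i> * of_real (y t j)) = (exp (\<i> * of_real (y t k)) :: complex)"
        then have "exp (\<i> * of_real (t * real j)) = (exp (\<i> * of_real (t * real k)) :: complex)"
          using True that by (simp add: y_def distrib_left exp_add)
        then obtain n :: int where "\<i> * of_real (t * real j) = \<i> * of_real (t * real k) + (of_int (2 * n) * pi) * \<i>"
          unfolding exp_eq by blast
        then have "\<i> * of_real (t * real j) = \<i> * of_real (t * real k + 2 * pi * of_int n)"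
          by (simp add: algebra_simps)
        then have "t * real j = t * real k + 2 * pi * of_int n"
          by (metis complex_i_not_zero mult_left_cancel of_real_eq_iff)
        then have n: "t * (real j - real k) = 2 * pi * of_int n" by (simp add: algebra_simps)
        then have "n \<noteq> 0" using elim that by auto
        then have "2 * pi * 1 \<le> 2 * pi * \<bar>real_of_int n\<bar>"
          by (intro mult_left_mono) auto
        also have "\<dots> = \<bar>t\<bar> * \<bar>real j - real k\<bar>"
          using arg_cong[OF n, of abs] by (simp add: abs_mult)
        also have "\<dots> \<le> \<bar>t\<bar> * real N" using that by (intro mult_left_mono) auto
        also have "\<dots> < r * real N" using elim that by (intro mult_strict_right_mono) auto
        also have "\<dots> = 2 * pi" using that by (simp add: r_def)
        finally show False by simp
      qed
    qed
  qed
  have "eventually (\<lambda>t. \<forall>j\<in>{..<N}. \<forall>k\<in>{..<N} - {j}.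
      exp (\<i> * of_real (y t j)) \<noteq> (exp (\<i> * of_real (y t k)) :: complex)) (at 0)"
    by (intro eventually_ball_finite ballI) (auto intro: pair)
  with ev1 have "eventually (\<lambda>t. y t \<in> T \<and> (\<forall>j\<in>{..<N}. \<forall>k\<in>{..<N} - {j}.
      exp (\<i> * of_real (y t j)) \<noteq> (exp (\<i> * of_real (y t k)) :: complex))) (at 0)"
    by (rule eventually_conj)
  from eventually_happens'[OF _ this] obtain t where t: "y t \<in> T"
    "\<And>j k. j < N \<Longrightarrow> k < N \<Longrightarrow> j \<noteq> k \<Longrightarrow> exp (\<i> * of_real (y t j)) \<noteq> (exp (\<i> * of_real (y t k)) :: complex)"
    by (auto simp: trivial_limit_at)
  have "\<Psi> N (cvec N) (y t) \<noteq> 0"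
    by (rule Psi_cvec_nonzero) (use t(2) in \<open>auto simp: inj_on_def\<close>)
  moreover have "y t \<in> RN N" using x by (auto simp: topspace_Euclidean_space y_def)
  ultimately show "\<exists>y\<in>{y \<in> RN N. \<Psi> N (cvec N) y \<noteq> 0}. y \<in> T \<and> y \<noteq> x"
    using t(1) zero by auto
qed

lemma continuous_schur_function:
  "continuous_on UNIV (\<lambda>x :: nat \<Rightarrow> real. exp (\<i> * of_int \<delta> * of_real (\<Sum>i<N. x i))
     * mpoly_eval p (\<lambda>j. exp (\<i> * of_real (x j))))"
  unfolding mpoly_eval_def by (intro continuous_intros) auto

lemma Psi_quot_shifted_weight:
  assumes la: "length la = N" and x: "x \<in> RN N"
  shows "\<Psi>_quot N (shifted_weight N \<delta> la) x =
    exp (\<i> * of_int \<delta> * of_real (\<Sum>i<N. x i)) * mpoly_eval (schur la) (\<lambda>j. exp (\<i> * of_real (x j)))"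
proof -
  define F where "F x = exp (\<i> * of_int \<delta> * of_real (\<Sum>i<N. x i))
    * mpoly_eval (schur la) (\<lambda>j. exp (\<i> * of_real (x j)))" for x :: "nat \<Rightarrow> real"
  have Psi: "\<Psi> N (shifted_weight N \<delta> la) y = F y * \<Psi> N (cvec N) y" for y
    unfolding F_def by (rule Psi_eq_schur_mult_Psi_cvec[OF la])
  show ?thesis
  proof (cases "\<Psi> N (cvec N) x = 0")
    case False
    then show ?thesis by (simp add: \<Psi>_quot_def Psi F_def)
  next
    case True
    let ?S = "{y \<in> RN N. \<Psi> N (cvec N) y \<noteq> 0}"
    have "(F \<longlongrightarrow> F x) (at x within ?S)"
      using continuous_schur_function[of \<delta> N "schur la"] unfolding F_def
      by (auto simp: continuous_on_def intro: tendsto_within_subset)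
    then have "((\<lambda>y. \<Psi> N (shifted_weight N \<delta> la) y / \<Psi> N (cvec N) y) \<longlongrightarrow> F x) (at x within ?S)"
      by (rule Lim_transform_eventually) (auto simp: Psi eventually_at_filter)
    moreover have "\<not> trivial_limit (at x within ?S)"
      using islimpt_nonzero_Psi_cvec[OF x True] by (simp add: trivial_limit_within)
    ultimately have "Lim (at x within ?S) (\<lambda>y. \<Psi> N (shifted_weight N \<delta> la) y / \<Psi> N (cvec N) y) = F x"
      by (intro tendsto_Lim)
    then show ?thesis using True by (simp add: \<Psi>_quot_def F_def)
  qed
qed

theorem proposition3p2:
  fixes N :: nat
  assumes "N \<ge> 1"
  shows "{restrict (\<Psi>_quot N m) (RN N) | m. m \<in> \<WW> N} =
    {(\<lambda>x\<in>RN N. exp (\<i> * of_int \<delta> * of_real (\<Sum>i<N. x i)) *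
                mpoly_eval (schur la) (\<lambda>j. exp (\<i> * of_real (x j)))) | (\<delta> :: int) la. la \<in> partitions N}"
proof -
  have quot: "restrict (\<Psi>_quot N (shifted_weight N \<delta> la)) (RN N) =
      (\<lambda>x\<in>RN N. exp (\<i> * of_int \<delta> * of_real (\<Sum>i<N. x i)) *
        mpoly_eval (schur la) (\<lambda>j. exp (\<i> * of_real (x j))))"
    if "la \<in> partitions N" for \<delta> la
    using that by (intro restrict_ext Psi_quot_shifted_weight) (auto simp: partitions_def)
  have "\<WW> N = {shifted_weight N \<delta> la | \<delta> la. la \<in> partitions N}"
    using shifted_weight_in_WW WW_eq_shifted_weight by blast
  then have "{restrict (\<Psi>_quot N m) (RN N) | m. m \<in> \<WW> N} =
      {restrict (\<Psi>_quot N (shifted_weight N \<delta> la)) (RN N) | \<delta> la. la \<in> partitions N}"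
    by auto
  then show ?thesis using quot by force
qed

end
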